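(* For every odd integer $d\geq 5$, one has $$e_r^*(d)\geq \frac{d^2-2d-1}{2d-4}=\frac{d}{2}-\frac{1}{2d-4}.$$
   Context: All polynomials have integer coefficients. For an integer polynomial $P(x)$ of degree $d\ge 2$, let $\mathrm{H}(P)$ denote its naïve height, i.e. the maximum of the absolute values of its coefficients. If $P$ has at least two distinct complex roots, its root separation is $$\mathrm{sep}(P):=\min_{\substack{P(\alpha)=P(\beta)=0,\\ \alpha\neq\beta}}|\alpha-\beta|,$$ where the minimum is over pairs of distinct complex roots of $P$. The quantity $e(P)$ is defined (when $\mathrm{H}(P)>1$) by $\mathrm{sep}(P)=\mathrm{H}(P)^{-e(P)}$, that is, $e(P)=-\log \mathrm{sep}(P)/\log \mathrm{H}(P)$. For $d\ge 2$, set $$e_r^*(d):=\limsup_{\deg(P)=d,\ \mathrm{H}(P)\to+\infty} e(P)=\lim_{H\to+\infty}\ \sup\{e(P): \deg P=d,\ \mathrm{H}(P)\ge H\},$$ where $P$ ranges over the monic integer polynomials of degree $d$ that are reducible over $\mathbb{Q}$ and have at least two distinct complex roots (the roots are not required to be simple). *)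

theory Defs
  imports
    "HOL-Computational_Algebra.Computational_Algebra"
    "HOL-Library.Extended_Real"
    "HOL-Library.Liminf_Limsup"
    "HOL-Analysis.Extended_Real_Limits"
begin

definition naive_height :: "int poly \<Rightarrow> int" where
  "naive_height P = Max ((\<lambda>i. \<bar>coeff P i\<bar>) ` {..degree P})"

definition complex_roots :: "int poly \<Rightarrow> complex set" where
  "complex_roots P = {z. poly (map_poly of_int P) z = 0}"

text \<open>The minimum below is over a finite set whenever \<open>P \<noteq> 0\<close>; it is over a nonempty set
  exactly when \<open>P\<close> has at least two distinct complex roots.\<close>

definition sep :: "int poly \<Rightarrow> real" where
  "sep P = Min {cmod (\<alpha> - \<beta>) | \<alpha> \<beta>. \<alpha> \<in> complex_roots P \<and> \<beta> \<in> complex_roots P \<and> \<alpha> \<noteq> \<beta>}"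

text \<open>Meaningful only when the height is greater than 1 (for height 1 the value is 0 by the
  convention for division by zero).\<close>

definition sep_exponent :: "int poly \<Rightarrow> real" where
  "sep_exponent P = - ln (sep P) / ln (real_of_int (naive_height P))"

definition monic_reducible_polys :: "nat \<Rightarrow> int poly set" where
  "monic_reducible_polys d =
     {P. degree P = d \<and> lead_coeff P = 1
         \<and> \<not> irreducible (map_poly of_int P :: rat poly)
         \<and> (\<exists>\<alpha>\<in>complex_roots P. \<exists>\<beta>\<in>complex_roots P. \<alpha> \<noteq> \<beta>)}"

text \<open>Values are extended reals, since finiteness of the upper limit is not
  part of the definition. The filter expresses that \<open>P\<close> ranges over the given
  class while its height tends to infinity.\<close>

definition e_r_star :: "nat \<Rightarrow> ereal" where
  "e_r_star d =
     Limsup (inf (filtercomap naive_height at_top) (principal (monic_reducible_polys d)))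
       (\<lambda>P. ereal (sep_exponent P))"

lemma e_r_star_tendsto:
  "((\<lambda>H. SUP P\<in>{P \<in> monic_reducible_polys d. naive_height P \<ge> H}. ereal (sep_exponent P))
      \<longlongrightarrow> e_r_star d) at_top"
proof -
  let ?F = "inf (filtercomap naive_height at_top) (principal (monic_reducible_polys d))"
  let ?A = "\<lambda>H. {P \<in> monic_reducible_polys d. naive_height P \<ge> H}"
  let ?g = "\<lambda>H. SUP P\<in>?A H. ereal (sep_exponent P)"
  have ev: "eventually Q ?F \<longleftrightarrow> (\<exists>H. \<forall>P\<in>?A H. Q P)" for Q
    by (auto simp: eventually_inf_principal eventually_filtercomap eventually_at_top_linorder)
  have le: "e_r_star d \<le> ?g H" for H
    unfolding e_r_star_def Limsup_def
    by (rule INF_lower2[of "\<lambda>P. P \<in> ?A H"]) (auto simp: ev)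
  have ge: "\<exists>H. ?g H < y" if "e_r_star d < y" for y
  proof -
    from that obtain Q where Q: "eventually Q ?F" "(SUP P\<in>Collect Q. ereal (sep_exponent P)) < y"
      unfolding e_r_star_def Limsup_def INF_less_iff by auto
    then obtain H where "\<forall>P\<in>?A H. Q P" by (auto simp: ev)
    then have "?g H \<le> (SUP P\<in>Collect Q. ereal (sep_exponent P))"
      by (intro SUP_subset_mono) auto
    with Q show ?thesis by (meson le_less_trans)
  qed
  have anti: "?g K \<le> ?g H" if "H \<le> K" for H K
    using that by (intro SUP_subset_mono) auto
  show ?thesis
  proof (rule order_tendstoI)
    fix y assume "y < e_r_star d"
    then show "\<forall>\<^sub>F H in at_top. y < ?g H" by (simp add: less_le_trans[OF _ le])
  next
    fix y assume "e_r_star d < y"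
    then obtain H where "?g H < y" using ge by blast
    then show "\<forall>\<^sub>F H in at_top. ?g H < y"
      unfolding eventually_at_top_linorder using anti le_less_trans by blast
  qed
qed

end

theory Submission
  imports Defs "HOL-Real_Asymp.Real_Asymp"
begin

text \<open>
  Write \<open>d = 2k + 3\<close>. For an integer parameter \<open>t\<close> put
  \<open>A = x\<^sup>2 - t\<^bsup>k+1\<^esup> x - t\<close> and \<open>B = 1 + (\<Sum>i\<le>k. t\<^bsup>k-i\<^esup> x\<^bsup>2i+1\<^esup>)\<close>.
  They satisfy \<open>(x\<^sup>2 - t) B = x\<^sup>d + A\<close>. Hence at the root \<open>\<alpha>\<close> of \<open>A\<close> in
  the interval from \<open>-t\<^bsup>-k\<^esup>\<close> to \<open>0\<close> the value \<open>B(\<alpha>) = \<alpha>\<^sup>d / (\<alpha>\<^sup>2 - t)\<close>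
  is positive and \<open>O(t\<^bsup>-kd-1\<^esup>)\<close>. As \<open>B\<close> increases on the real line with slope at
  least \<open>t\<^bsup>k\<^esup>\<close>, it has a root at distance \<open>O(t\<^bsup>-kd-k-1\<^esup>)\<close> from \<open>\<alpha>\<close>, whereas
  the height of \<open>A B\<close> is \<open>O(t\<^bsup>2k+1\<^esup>)\<close>. Letting \<open>t\<close> tend to infinity gives the
  exponent \<open>(kd + k + 1) / (2k + 1)\<close>.
\<close>

subsection \<open>Integer polynomials as complex and rational polynomials\<close>

lemma map_poly_of_int_mult:
  "map_poly of_int (P * Q) = (map_poly of_int P * map_poly of_int Q :: 'a :: comm_ring_1 poly)"
  by (rule poly_eqI) (simp add: coeff_map_poly coeff_mult)

lemma map_poly_of_int_add:
  "map_poly of_int (P + Q) = (map_poly of_int P + map_poly of_int Q :: 'a :: comm_ring_1 poly)"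
  by (rule poly_eqI) (simp add: coeff_map_poly)

lemma map_poly_of_int_smult:
  "map_poly of_int (smult c P) = (smult (of_int c) (map_poly of_int P) :: 'a :: comm_ring_1 poly)"
  by (rule poly_eqI) (simp add: coeff_map_poly)

lemma poly_map_poly_of_int_of_real:
  "poly (map_poly of_int P) (complex_of_real x) = of_real (poly (map_poly of_int P) x)"
  by (simp add: poly_altdef coeff_map_poly degree_map_poly)

text \<open>Over a field the units are the nonzero constants, so factors of positive degree witness
  reducibility.\<close>

lemma not_irreducible_map_poly_mult:
  assumes "degree P > 0" "degree Q > 0"
  shows "\<not> irreducible (map_poly of_int (P * Q) :: rat poly)"
proof
  assume "irreducible (map_poly of_int (P * Q) :: rat poly)"
  then have "is_unit (map_poly of_int P :: rat poly) \<or> is_unit (map_poly of_int Q :: rat poly)"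
    unfolding map_poly_of_int_mult by (rule irreducibleD) simp
  moreover have "degree (map_poly of_int R :: rat poly) = degree R" for R
    by (simp add: degree_map_poly)
  ultimately show False
    using assms by (metis is_unit_iff_degree degree_0 less_irrefl)
qed

lemma finite_complex_roots:
  assumes "P \<noteq> 0"
  shows "finite (complex_roots P)"
  unfolding complex_roots_def using assms
  by (intro poly_roots_finite) (auto simp: poly_eq_iff coeff_map_poly)

text \<open>\<open>Min\<close> is informative only on a finite nonempty set: there are finitely many
  roots, and the given pair supplies an element. The minimum is then attained at two distinct roots,
  hence positive, so its logarithm is meaningful.\<close>

lemma sep_bounds:
  assumes "P \<noteq> 0" "\<alpha> \<in> complex_roots P" "\<beta> \<in> complex_roots P" "\<alpha> \<noteq> \<beta>"
  shows "0 < sep P" "sep P \<le> cmod (\<alpha> - \<beta>)"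
proof -
  let ?D = "{cmod (\<alpha> - \<beta>) | \<alpha> \<beta>. \<alpha> \<in> complex_roots P \<and> \<beta> \<in> complex_roots P \<and> \<alpha> \<noteq> \<beta>}"
  have "?D \<subseteq> (\<lambda>(\<alpha>, \<beta>). cmod (\<alpha> - \<beta>)) ` (complex_roots P \<times> complex_roots P)"
    by auto
  then have fin: "finite ?D"
    using finite_complex_roots[OF assms(1)] by (intro finite_subset[OF \<open>?D \<subseteq> _\<close>]) simp
  have mem: "cmod (\<alpha> - \<beta>) \<in> ?D"
    using assms by blast
  have "Min ?D \<in> ?D"
    using Min_in[OF fin] mem by blast
  then show "0 < sep P"
    unfolding sep_def by auto
  show "sep P \<le> cmod (\<alpha> - \<beta>)"
    unfolding sep_def using fin mem by (rule Min_le)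
qed

lemma naive_height_le:
  assumes "\<And>i. \<bar>coeff P i\<bar> \<le> C"
  shows "naive_height P \<le> C"
  unfolding naive_height_def using assms by (subst Max_le_iff) auto

lemma abs_coeff_le_naive_height: "\<bar>coeff P i\<bar> \<le> naive_height P"
proof (cases "i \<le> degree P")
  case True
  then show ?thesis
    unfolding naive_height_def by (intro Max_ge) auto
next
  case False
  then have "\<bar>coeff P i\<bar> \<le> \<bar>coeff P 0\<bar>"
    by (simp add: coeff_eq_0)
  also have "\<dots> \<le> naive_height P"
    unfolding naive_height_def by (intro Max_ge) auto
  finally show ?thesis .
qed

subsection \<open>The family of polynomials\<close>

text \<open>The geometric sum x (x^(2k+2) - t^(k+1)) / (x^2 - t). The recursion in k lets the closed
  form and the slope bound go by induction.\<close>

primrec odd_sum :: "int \<Rightarrow> nat \<Rightarrow> int poly" where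
  "odd_sum t 0 = monom 1 1"
| "odd_sum t (Suc k) = smult t (odd_sum t k) + monom 1 (2 * k + 3)"

text \<open>The coefficients are those left over when (x^2 - t) (1 + \<open>odd_sum t k\<close>) is
  reduced by its top term x^(2k+3).\<close>

definition quad_factor :: "int \<Rightarrow> nat \<Rightarrow> int poly" where
  "quad_factor t k = [:- t, - (t ^ (k + 1)), 1:]"

definition odd_factor :: "int \<Rightarrow> nat \<Rightarrow> int poly" where
  "odd_factor t k = 1 + odd_sum t k"

lemma coeff_odd_sum:
  "coeff (odd_sum t k) j = (if odd j \<and> j \<le> 2 * k + 1 then t ^ (k - j div 2) else 0)"
proof (induction k arbitrary: j)
  case 0
  show ?case by (auto simp: le_Suc_eq)
next
  case (Suc k)
  consider "j \<le> 2 * k + 1" | "j = 2 * k + 2" | "j = 2 * k + 3" | "j > 2 * k + 3"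
    by linarith
  then show ?case
  proof cases
    case 1
    \<comment> \<open>Here j div 2 \<le> k, so the truncated subtraction is exact.\<close>
    then have "Suc k - j div 2 = Suc (k - j div 2)"
      by linarith
    with 1 show ?thesis by (simp add: Suc)
  qed (simp_all add: Suc)
qed

lemma abs_coeff_odd_factor_le:
  assumes "t \<ge> 1"
  shows "\<bar>coeff (odd_factor t k) j\<bar> \<le> t ^ k"
proof -
  have "t ^ (k - j div 2) \<le> t ^ k" "1 \<le> t ^ k"
    using assms by (simp_all add: power_increasing)
  then show ?thesis
    using assms by (auto simp: odd_factor_def coeff_odd_sum coeff_1)
qed

lemma degree_odd_factor: "degree (odd_factor t k) = 2 * k + 1"
  and lead_coeff_odd_factor: "lead_coeff (odd_factor t k) = 1"
proof -
  have "coeff (odd_factor t k) (2 * k + 1) = 1"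
    by (simp add: odd_factor_def coeff_odd_sum coeff_1)
  moreover have "\<forall>i > 2 * k + 1. coeff (odd_factor t k) i = 0"
    by (simp add: odd_factor_def coeff_odd_sum coeff_1)
  ultimately show "degree (odd_factor t k) = 2 * k + 1"
    by (intro antisym degree_le le_degree) auto
  then show "lead_coeff (odd_factor t k) = 1"
    using \<open>coeff (odd_factor t k) (2 * k + 1) = 1\<close> by simp
qed

section \<open>Values of the two factors on the real line\<close>

lemma poly_quad_factor:
  "poly (map_poly of_int (quad_factor t k)) (x :: real) = x ^ 2 - of_int t ^ (k + 1) * x - of_int t"
  by (simp add: quad_factor_def map_poly_pCons power2_eq_square algebra_simps)

lemma poly_odd_sum_Suc:
  "poly (map_poly of_int (odd_sum t (Suc k))) (x :: real) =
     of_int t * poly (map_poly of_int (odd_sum t k)) x + x ^ (2 * k + 3)"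
  by (simp add: map_poly_of_int_add map_poly_of_int_smult map_poly_monom poly_monom)

lemma poly_odd_sum_mult:
  "(x ^ 2 - of_int t) * poly (map_poly of_int (odd_sum t k)) (x :: real) =
     x ^ (2 * k + 3) - of_int t ^ (k + 1) * x"
proof (induction k)
  case 0
  show ?case
    by (simp add: map_poly_monom poly_monom algebra_simps power2_eq_square power3_eq_cube)
next
  case (Suc k)
  have "(x ^ 2 - of_int t) * poly (map_poly of_int (odd_sum t (Suc k))) x =
      of_int t * ((x ^ 2 - of_int t) * poly (map_poly of_int (odd_sum t k)) x)
      + (x ^ 2 - of_int t) * x ^ (2 * k + 3)"
    unfolding poly_odd_sum_Suc by (simp add: algebra_simps)
  also have "\<dots> = x ^ (2 * Suc k + 3) - of_int t ^ (Suc k + 1) * x"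
    unfolding Suc by (simp add: algebra_simps power_add numeral_eq_Suc)
  finally show ?case .
qed

lemma poly_odd_factor:
  "poly (map_poly of_int (odd_factor t k)) (x :: real) =
     1 + poly (map_poly of_int (odd_sum t k)) x"
  by (simp add: odd_factor_def map_poly_of_int_add)

lemma poly_factors_identity:
  "(x ^ 2 - of_int t) * poly (map_poly of_int (odd_factor t k)) (x :: real) =
     x ^ (2 * k + 3) + poly (map_poly of_int (quad_factor t k)) x"
  using poly_odd_sum_mult[of x t k]
  by (simp add: poly_odd_factor poly_quad_factor algebra_simps)

text \<open>Every term is an odd power with nonnegative coefficient, hence monotone on the whole
  line; the linear term t^k x alone already gives the slope.\<close>

lemma poly_odd_factor_slope:
  assumes "t \<ge> 0" "y \<le> (x :: real)"
  shows "of_int t ^ k * (x - y) \<le>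
    poly (map_poly of_int (odd_factor t k)) x - poly (map_poly of_int (odd_factor t k)) y"
proof -
  have "of_int t ^ k * (x - y) \<le>
    poly (map_poly of_int (odd_sum t k)) x - poly (map_poly of_int (odd_sum t k)) y"
  proof (induction k)
    case 0
    show ?case by (simp add: map_poly_monom poly_monom)
  next
    case (Suc k)
    have "y ^ (2 * k + 3) \<le> x ^ (2 * k + 3)"
      using assms by (intro power_mono_odd) auto
    moreover have "of_int t * (of_int t ^ k * (x - y)) \<le>
        of_int t * (poly (map_poly of_int (odd_sum t k)) x
          - poly (map_poly of_int (odd_sum t k)) y)"
      using assms Suc by (intro mult_left_mono) auto
    ultimately show ?case
      unfolding poly_odd_sum_Suc by (simp add: algebra_simps)
  qed
  then show ?thesis by (simp add: poly_odd_factor)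
qed

lemma close_roots:
  fixes t :: int
  assumes "t \<ge> 2"
  obtains \<alpha> \<beta> :: real
  where "poly (map_poly of_int (quad_factor t k)) \<alpha> = 0"
    and "poly (map_poly of_int (odd_factor t k)) \<beta> = 0"
    and "\<alpha> \<noteq> \<beta>"
    and "\<bar>\<alpha> - \<beta>\<bar> \<le> 2 / of_int t ^ (k * (2 * k + 3) + k + 1)"
proof -
  define T where "T = real_of_int t"
  have T: "T \<ge> 2" using assms by (simp add: T_def)
  let ?A = "\<lambda>x :: real. poly (map_poly of_int (quad_factor t k)) x"
  let ?B = "\<lambda>x :: real. poly (map_poly of_int (odd_factor t k)) x"
  let ?s = "1 / T ^ k"
  have s: "0 < ?s" "?s \<le> 1"
    using T by (auto simp: one_le_power)
  \<comment> \<open>The endpoint -1/T^k is chosen so that the linear term contributes +T and cancels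
    the constant term -T.\<close>
  have "?A (- ?s) = ?s ^ 2"
    using T by (simp add: poly_quad_factor T_def[symmetric] field_simps)
  then have "?A 0 \<le> 0" "0 \<le> ?A (- ?s)"
    using T by (simp_all add: poly_quad_factor T_def[symmetric])
  then have "\<exists>x\<ge>- ?s. x \<le> 0 \<and> ?A x = 0"
    using s by (intro IVT2' continuous_on_poly continuous_on_id) auto
  then obtain \<alpha> where \<alpha>: "- ?s \<le> \<alpha>" "\<alpha> \<le> 0" "?A \<alpha> = 0"
    by blast
  have "\<alpha> \<noteq> 0"
    using \<alpha>(3) T by (auto simp: poly_quad_factor T_def[symmetric])
  with \<alpha> have neg: "\<alpha> < 0" by simp
  have sq: "\<alpha> ^ 2 \<le> 1"
  proof -
    have "- 1 \<le> \<alpha>" using \<alpha>(1) s(2) by linarith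
    then show ?thesis using neg by (simp add: abs_square_le_1 abs_le_iff)
  qed
  \<comment> \<open>The exponent is odd, so flipping the sign of T - \<alpha>^2 turns \<alpha> into
    -\<alpha> and makes the right-hand side positive.\<close>
  have B\<alpha>: "(T - \<alpha> ^ 2) * ?B \<alpha> = (- \<alpha>) ^ (2 * k + 3)"
    using poly_factors_identity[of \<alpha> t k] \<alpha>(3)
    by (simp add: T_def[symmetric] algebra_simps)
  have "0 < (T - \<alpha> ^ 2) * ?B \<alpha>"
    unfolding B\<alpha> using neg by (intro zero_less_power) auto
  then have pos: "0 < ?B \<alpha>"
    using sq T by (auto simp: zero_less_mult_iff)
  \<comment> \<open>T - \<alpha>^2 \<ge> T/2 because \<alpha>^2 \<le> 1 \<le> T/2.\<close>
  have "(T / 2) * ?B \<alpha> \<le> (T - \<alpha> ^ 2) * ?B \<alpha>"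
    using pos sq T by (intro mult_right_mono) auto
  also have "\<dots> \<le> ?s ^ (2 * k + 3)"
    unfolding B\<alpha> using \<alpha> by (intro power_mono) auto
  finally have small: "?B \<alpha> \<le> 2 / T * ?s ^ (2 * k + 3)"
    using T by (simp add: field_simps)
  \<comment> \<open>At slope at least T^k, moving left by h lowers B by at least B(\<alpha>), so a
    root is trapped in between.\<close>
  define h where "h = ?B \<alpha> / T ^ k"
  have h0: "0 < h" using pos T by (simp add: h_def)
  have "?B (\<alpha> - h) \<le> 0"
    using poly_odd_factor_slope[of t "\<alpha> - h" \<alpha> k] assms h0 T
    by (simp add: T_def[symmetric] h_def)
  then have "\<exists>x\<ge>\<alpha> - h. x \<le> \<alpha> \<and> ?B x = 0"
    using pos h0 by (intro IVT' continuous_on_poly continuous_on_id) auto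
  then obtain \<beta> where \<beta>: "\<alpha> - h \<le> \<beta>" "\<beta> \<le> \<alpha>" "?B \<beta> = 0"
    by blast
  have "h \<le> 2 / T * ?s ^ (2 * k + 3) / T ^ k"
    unfolding h_def using small T by (intro divide_right_mono) auto
  \<comment> \<open>The exponent collects k (2k+3) from the power of \<open>?s\<close>, k from the
    slope and 1 from the factor T - \<alpha>^2.\<close>
  also have "\<dots> = 2 / T ^ (k * (2 * k + 3) + k + 1)"
    by (simp add: power_divide power_mult power_add)
  finally have "h \<le> 2 / T ^ (k * (2 * k + 3) + k + 1)" .
  \<comment> \<open>The roots differ since B is positive at \<alpha> and zero at \<beta>.\<close>
  then show ?thesis
    using \<alpha>(3) \<beta> pos by (intro that[of \<alpha> \<beta>]) (auto simp: T_def)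
qed

section \<open>Height and separation of the product\<close>

lemma coeff_quad_factor_mult:
  "\<bar>coeff (quad_factor t k * Q) i\<bar> \<le> (\<bar>t\<bar> + \<bar>t\<bar> ^ (k + 1) + 1) * C"
  if C: "\<And>j. \<bar>coeff Q j\<bar> \<le> C"
proof -
  have C0: "0 \<le> C" using C[of 0] by linarith
  \<comment> \<open>Multiplication by x only shifts coefficients, so each coefficient of the product
    combines three coefficients of Q, with the absolute values of the quadratic's coefficients as
    weights.\<close>
  have eq: "quad_factor t k * Q = smult (- t) Q + smult (- (t ^ (k + 1))) (pCons 0 Q) + pCons 0 (pCons 0 Q)"
    by (simp add: quad_factor_def)
  have 1: "\<bar>coeff (pCons 0 R) j\<bar> \<le> C" if "\<And>j. \<bar>coeff R j\<bar> \<le> C" for R j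
    using that C0 by (cases j) auto
  have "\<bar>- t * coeff Q i\<bar> \<le> \<bar>t\<bar> * C"
    using C[of i] by (simp add: abs_mult mult_left_mono)
  moreover have "\<bar>- (t ^ (k + 1)) * coeff (pCons 0 Q) i\<bar> \<le> \<bar>t\<bar> ^ (k + 1) * C"
    unfolding abs_mult abs_minus_cancel power_abs
    by (intro mult_left_mono 1 C) auto
  moreover have "\<bar>coeff (pCons 0 (pCons 0 Q)) i\<bar> \<le> C"
    by (intro 1 C)
  ultimately show ?thesis
    unfolding eq coeff_add coeff_smult distrib_right mult_1 by linarith
qed

definition close_poly :: "int \<Rightarrow> nat \<Rightarrow> int poly" where
  "close_poly t k = quad_factor t k * odd_factor t k"

lemma naive_height_close_poly_le:
  assumes "t \<ge> 1"
  shows "naive_height (close_poly t k) \<le> 3 * t ^ (2 * k + 1)"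
proof (rule naive_height_le)
  fix i
  have "\<bar>coeff (close_poly t k) i\<bar> \<le> (\<bar>t\<bar> + \<bar>t\<bar> ^ (k + 1) + 1) * t ^ k"
    unfolding close_poly_def
    by (intro coeff_quad_factor_mult abs_coeff_odd_factor_le assms)
  also have "\<dots> \<le> (3 * t ^ (k + 1)) * t ^ k"
  proof -
    \<comment> \<open>Each of t, t^(k+1) and 1 is at most t^(k+1), whence the constant 3.\<close>
    have "1 \<le> t ^ k" using assms by simp
    then have "t \<le> t ^ (k + 1)" using assms by simp
    then have "t + t ^ (k + 1) + 1 \<le> 3 * t ^ (k + 1)" using assms by linarith
    then have "(t + t ^ (k + 1) + 1) * t ^ k \<le> 3 * t ^ (k + 1) * t ^ k"
      using assms by (intro mult_right_mono) auto
    then show ?thesis using assms by simp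
  qed
  also have "\<dots> = 3 * t ^ (2 * k + 1)"
    by (simp add: mult_2 power_add)
  finally show "\<bar>coeff (close_poly t k) i\<bar> \<le> 3 * t ^ (2 * k + 1)" .
qed

text \<open>The constant coefficient of the product is -t. This keeps the logarithm of the height
  positive and sends the height to infinity with t.\<close>

lemma naive_height_close_poly_ge:
  assumes "t \<ge> 0"
  shows "t \<le> naive_height (close_poly t k)"
  using abs_coeff_le_naive_height[of "close_poly t k" 0] assms
  by (simp add: close_poly_def quad_factor_def odd_factor_def coeff_mult_0 coeff_odd_sum)

lemma close_poly_properties:
  assumes "t \<ge> 2"
  shows "close_poly t k \<in> monic_reducible_polys (2 * k + 3)"
    and "0 < sep (close_poly t k)"
    and "sep (close_poly t k) \<le> 2 / of_int t ^ (k * (2 * k + 3) + k + 1)"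
proof -
  have quad: "degree (quad_factor t k) = 2" "lead_coeff (quad_factor t k) = 1"
    by (simp_all add: quad_factor_def)
  then have nz: "quad_factor t k \<noteq> 0" "odd_factor t k \<noteq> 0"
    using lead_coeff_odd_factor[of t k] by auto
  have deg: "degree (close_poly t k) = 2 * k + 3"
    unfolding close_poly_def using nz by (simp add: degree_mult_eq quad degree_odd_factor)
  have lead: "lead_coeff (close_poly t k) = 1"
    unfolding close_poly_def lead_coeff_mult by (simp only: quad(2) lead_coeff_odd_factor mult_1)
  have red: "\<not> irreducible (map_poly of_int (close_poly t k) :: rat poly)"
    unfolding close_poly_def
    by (intro not_irreducible_map_poly_mult) (simp_all add: quad degree_odd_factor)
  from close_roots[OF assms, of k] obtain \<alpha> \<beta> :: real
    where r: "poly (map_poly of_int (quad_factor t k)) \<alpha> = 0"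
      "poly (map_poly of_int (odd_factor t k)) \<beta> = 0" "\<alpha> \<noteq> \<beta>"
      "\<bar>\<alpha> - \<beta>\<bar> \<le> 2 / of_int t ^ (k * (2 * k + 3) + k + 1)"
    by metis
  have roots: "complex_of_real \<alpha> \<in> complex_roots (close_poly t k)"
      "complex_of_real \<beta> \<in> complex_roots (close_poly t k)"
      "complex_of_real \<alpha> \<noteq> complex_of_real \<beta>"
    using r by (simp_all add: complex_roots_def close_poly_def map_poly_of_int_mult
      poly_map_poly_of_int_of_real)
  then show "close_poly t k \<in> monic_reducible_polys (2 * k + 3)"
    unfolding monic_reducible_polys_def using deg lead red by blast
  have "close_poly t k \<noteq> 0"
    using nz by (simp add: close_poly_def)
  note sep_bounds[OF this roots]
  moreover have "cmod (complex_of_real \<alpha> - complex_of_real \<beta>) = \<bar>\<alpha> - \<beta>\<bar>"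
    by (metis norm_of_real of_real_diff)
  ultimately show "0 < sep (close_poly t k)"
      "sep (close_poly t k) \<le> 2 / of_int t ^ (k * (2 * k + 3) + k + 1)"
    using r(4) by simp_all
qed

section \<open>Separation exponents and their limit\<close>

lemma sep_exponent_close_poly_ge:
  fixes t :: int and k :: nat
  defines "N \<equiv> k * (2 * k + 3) + k + 1"
  assumes "t \<ge> 2"
  shows "(real N * ln (of_int t) - ln 2) / (real (2 * k + 1) * ln (of_int t) + ln 3)
    \<le> sep_exponent (close_poly t k)"
proof -
  let ?T = "real_of_int t" and ?H = "real_of_int (naive_height (close_poly t k))"
  have T: "?T \<ge> 2" using assms by simp
  have "?T \<le> ?H"
    using naive_height_close_poly_ge[of t k] assms by simp
  with T have H: "?H \<ge> 2" by linarith
  have "?H \<le> real_of_int (3 * t ^ (2 * k + 1))"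
    using naive_height_close_poly_le[of t k] assms by (intro of_int_le_iff[THEN iffD2]) auto
  then have "ln ?H \<le> ln (3 * ?T ^ (2 * k + 1))"
    using H by simp
  also have "\<dots> = real (2 * k + 1) * ln ?T + ln 3"
    using T by (simp add: ln_mult ln_realpow del: power_Suc)
  finally have lnH: "ln ?H \<le> real (2 * k + 1) * ln ?T + ln 3" .
  have "ln (sep (close_poly t k)) \<le> ln (2 / ?T ^ N)"
    using close_poly_properties[OF assms(2), of k] T unfolding N_def
    by (subst ln_le_cancel_iff) auto
  also have "\<dots> = ln 2 - real N * ln ?T"
    using T by (simp add: ln_div ln_realpow)
  finally have lnsep: "real N * ln ?T - ln 2 \<le> - ln (sep (close_poly t k))"
    by simp
  \<comment> \<open>A nonnegative numerator is required below: only then does replacing the height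
    by its upper bound in the denominator decrease the quotient. It holds because N \<ge> 1.\<close>
  have "ln 2 \<le> ln ?T" using T by simp
  also have "\<dots> \<le> real N * ln ?T"
    using T by (simp add: N_def algebra_simps)
  finally have "0 \<le> real N * ln ?T - ln 2" by simp
  then show ?thesis
    unfolding sep_exponent_def using lnsep lnH H
    by (intro frac_le) auto
qed

theorem mainTheorem2:
  fixes d :: nat
  assumes "odd d" and "d \<ge> 5"
  shows "e_r_star d \<ge> ereal ((real d ^ 2 - 2 * real d - 1) / (2 * real d - 4))
    \<and> (real d ^ 2 - 2 * real d - 1) / (2 * real d - 4) = real d / 2 - 1 / (2 * real d - 4)"
proof
  show "(real d ^ 2 - 2 * real d - 1) / (2 * real d - 4) = real d / 2 - 1 / (2 * real d - 4)"
    using assms(2) by (simp add: field_simps power2_eq_square)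
next
  obtain k where d: "d = 2 * k + 3"
  proof -
    have "d = 2 * ((d - 3) div 2) + 3" using assms by presburger
    then show thesis by (rule that)
  qed
  define N where "N = k * (2 * k + 3) + k + 1"
  let ?f = "\<lambda>n :: nat. (real N * ln (real n) - ln 2) / (real (2 * k + 1) * ln (real n) + ln 3)"
  \<comment> \<open>The constants 2 and 3 contribute bounded terms that vanish against ln n.\<close>
  have "?f \<longlonglongrightarrow> real N / (2 * real k + 1)"
    by (real_asymp simp: field_simps)
  \<comment> \<open>With d = 2k + 3 one has 2k + 1 = d - 2 and 2N = 4k^2 + 8k + 2 = d^2 - 2d -
    1.\<close>
  also have "real N / (2 * real k + 1) = (real d ^ 2 - 2 * real d - 1) / (2 * real d - 4)"
    by (simp add: N_def d field_simps power2_eq_square)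
  finally have lim: "(\<lambda>n. ereal (?f n)) \<longlonglongrightarrow>
      ereal ((real d ^ 2 - 2 * real d - 1) / (2 * real d - 4))"
    by simp
  \<comment> \<open>For each fixed H all sufficiently late members of the family have height at
    least H, so the limit of their lower bounds stays below the supremum; the bound then passes to
    the limit in H.\<close>
  have "ereal ((real d ^ 2 - 2 * real d - 1) / (2 * real d - 4)) \<le>
      (SUP P\<in>{P \<in> monic_reducible_polys d. naive_height P \<ge> H}. ereal (sep_exponent P))" for H
  proof (rule LIMSEQ_le_const2[OF lim], intro exI allI impI)
    \<comment> \<open>The 2 serves the root estimates; \<open>nat H\<close> secures height at least
      H, being 0 for negative H.\<close>
    fix n :: nat assume n: "n \<ge> max 2 (nat H)"
    have "ereal (?f n) \<le> ereal (sep_exponent (close_poly (int n) k))"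
      using sep_exponent_close_poly_ge[of "int n" k] n by (simp add: N_def)
    also have "\<dots> \<le> (SUP P\<in>{P \<in> monic_reducible_polys d. naive_height P \<ge> H}.
        ereal (sep_exponent P))"
    proof (rule SUP_upper)
      have "H \<le> int n" using n by linarith
      also have "\<dots> \<le> naive_height (close_poly (int n) k)"
        by (rule naive_height_close_poly_ge) simp
      finally show "close_poly (int n) k \<in>
          {P \<in> monic_reducible_polys d. naive_height P \<ge> H}"
        using close_poly_properties(1)[of "int n" k] n d by simp
    qed
    finally show "ereal (?f n) \<le>
      (SUP P\<in>{P \<in> monic_reducible_polys d. naive_height P \<ge> H}. ereal (sep_exponent P))" .
  qed
  then show "ereal ((real d ^ 2 - 2 * real d - 1) / (2 * real d - 4)) \<le> e_r_star d"
    by (intro tendsto_lowerbound[OF e_r_star_tendsto]) auto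
qed

end
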